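(* Let $(\alpha,\beta)$ be a random vector in $\mathbb{R}^2$ such that (i) $\mathbb{P}(\alpha\neq 0)=1$; (ii) $\mathbb{P}(|\alpha|\neq 1)>0$; (iii) for every $c\in\mathbb{R}$, $\mathbb{P}(\alpha(c-\beta)=c)<1$. Assume that $$0<\mathbb{E}\{\ln|\alpha|\}<\infty,\qquad \mathbb{E}\{\ln\max(|\beta|,1)\}<\infty .$$ Let $y:\mathbb{R}\to\mathbb{R}$ be a bounded (not necessarily continuous) solution of $$y(x)=\mathbb{E}\{y(\alpha(x-\beta))\},\qquad x\in\mathbb{R},$$ such that the limits $L^{\pm}:=\lim_{x\to\pm\infty}y(x)$ exist. (a) Suppose that $\mathbb{P}(\alpha>0)=1$. Then $$y(x)=(L^{+}-L^{-})\,F_\Upsilon(x)+L^{-},\qquad x\in\mathbb{R},$$ where $F_\Upsilon$ is the distribution function of the random series $\Upsilon$ defined in the context. In particular, $y$ is continuous everywhere on $\mathbb{R}$. (b) If $\mathbb{P}(\alpha<0)>0$, then $y$ is constant on $\mathbb{R}$.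
   Context: A bounded solution means a bounded Borel measurable function $y:\mathbb{R}\to\mathbb{R}$ satisfying the equation for every $x\in\mathbb{R}$. Let $(\alpha_n,\beta_n)_{n\ge1}$ be independent random pairs, each with the same distribution as $(\alpha,\beta)$. Put $A_0:=1$ and $A_n:=\prod_{i=1}^n\alpha_i$ for $n\ge1$. The random series $\Upsilon$ is $$\Upsilon:=\sum_{n=1}^\infty \beta_n A_{n-1}^{-1}=\beta_1+\beta_2\alpha_1^{-1}+\beta_3\alpha_1^{-1}\alpha_2^{-1}+\cdots,$$ which converges almost surely under the stated assumptions, and $F_\Upsilon(x):=\mathbb{P}(\Upsilon\le x)$, $x\in\mathbb{R}$. The variables $\alpha$ and $\beta$ need not be independent of each other. *)

theory Defs
  imports "HOL-Probability.Probability"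
begin

definition bounded_solution ::
    "'a measure \<Rightarrow> ('a \<Rightarrow> real) \<Rightarrow> ('a \<Rightarrow> real) \<Rightarrow> (real \<Rightarrow> real) \<Rightarrow> bool" where
  "bounded_solution M \<alpha> \<beta> y \<longleftrightarrow>
     y \<in> borel_measurable borel \<and> bounded (range y) \<and>
     (\<forall>x. y x = (\<integral>\<omega>. y (\<alpha> \<omega> * (x - \<beta> \<omega>)) \<partial>M))"

text \<open>The copies may live on a probability space \<open>N\<close> other than the space \<open>M\<close> of
  \<open>(\<alpha>, \<beta>)\<close>. Different pairs are independent; within a pair no independence is imposed.
  Indices start at 1, so \<open>a 0\<close> and \<open>b 0\<close> are irrelevant.\<close>

definition iid_copies ::
    "'a measure \<Rightarrow> ('a \<Rightarrow> real) \<Rightarrow> ('a \<Rightarrow> real) \<Rightarrow>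
     'b measure \<Rightarrow> (nat \<Rightarrow> 'b \<Rightarrow> real) \<Rightarrow> (nat \<Rightarrow> 'b \<Rightarrow> real) \<Rightarrow> bool" where
  "iid_copies M \<alpha> \<beta> N a b \<longleftrightarrow>
     prob_space N \<and>
     prob_space.indep_vars N (\<lambda>_. borel) (\<lambda>n \<omega>. (a n \<omega>, b n \<omega>)) {1..} \<and>
     (\<forall>n\<ge>1. distr N borel (\<lambda>\<omega>. (a n \<omega>, b n \<omega>)) = distr M borel (\<lambda>\<omega>. (\<alpha> \<omega>, \<beta> \<omega>)))"

definition partial_product :: "(nat \<Rightarrow> 'b \<Rightarrow> real) \<Rightarrow> nat \<Rightarrow> 'b \<Rightarrow> real" where
  "partial_product a n \<omega> = (\<Prod>i=1..n. a i \<omega>)"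

text \<open>The \<open>n\<close>-th term (\<open>n \<ge> 0\<close>) is \<open>\<beta>\<^sub>n\<^sub>+\<^sub>1 A\<^sub>n\<^sup>-\<^sup>1\<close>, i.e. the usual series over
  \<open>n \<ge> 1\<close> shifted by one.\<close>

definition Upsilon_term ::
    "(nat \<Rightarrow> 'b \<Rightarrow> real) \<Rightarrow> (nat \<Rightarrow> 'b \<Rightarrow> real) \<Rightarrow> 'b \<Rightarrow> nat \<Rightarrow> real" where
  "Upsilon_term a b \<omega> n = b (Suc n) \<omega> * inverse (partial_product a n \<omega>)"

definition Upsilon ::
    "(nat \<Rightarrow> 'b \<Rightarrow> real) \<Rightarrow> (nat \<Rightarrow> 'b \<Rightarrow> real) \<Rightarrow> 'b \<Rightarrow> real" where
  "Upsilon a b \<omega> = (\<Sum>n. Upsilon_term a b \<omega> n)"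

definition F_Upsilon ::
    "'b measure \<Rightarrow> (nat \<Rightarrow> 'b \<Rightarrow> real) \<Rightarrow> (nat \<Rightarrow> 'b \<Rightarrow> real) \<Rightarrow> real \<Rightarrow> real" where
  "F_Upsilon N a b = cdf (distr N borel (Upsilon a b))"

end

theory Submission imports Defs begin

text \<open>
  Iterating the equation gives \<open>y x = E (y (X\<^sub>n))\<close>, where
  \<open>X\<^sub>n = A\<^sub>n (x - (\<beta>\<^sub>1 + \<dots> + \<beta>\<^sub>n / A\<^sub>n\<^sub>-\<^sub>1))\<close> is the forward orbit of \<open>x\<close>. Since \<open>|A\<^sub>n|\<close> grows
  exponentially, \<open>|X\<^sub>n| \<rightarrow> \<infinity>\<close> off the event \<open>\<Upsilon> = x\<close>, and for positive \<open>\<alpha>\<close> the sign of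
  \<open>x - \<Upsilon>\<close> decides which of the two limits of \<open>y\<close> is picked up; dominated convergence
  concludes. If \<open>\<alpha>\<close> is negative with positive probability, letting \<open>x \<rightarrow> \<infinity>\<close> in the
  equation already forces \<open>L\<^sup>+ = L\<^sup>-\<close>.

  The event \<open>\<Upsilon> = x\<close> is null because \<open>x \<mapsto> P (\<Upsilon> = x)\<close> solves the same equation: the finite
  set on which it is maximal is almost surely permuted by the affine map \<open>z \<mapsto> \<alpha> (z - \<beta>)\<close>, so
  either it is a single almost sure fixed point or \<open>|\<alpha>| = 1\<close> almost surely.

  No law of large numbers is needed for the growth of \<open>|A\<^sub>n|\<close>: it suffices that a random walk
  with positive drift is bounded below, and this follows from one shift of the underlying product
  space.
\<close>

section \<open>Product space: splitting off the first coordinate\<close>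

context sequence_space
begin

lemma pair_prob_space_PiM: "pair_prob_space M S"
  ..

text \<open>Prefixing an independent coordinate to a path preserves the product law
  (\<open>PiM_iter\<close>). The uniform bound on \<open>h\<close> gives the integrability that
  Fubini requires.\<close>

lemma integral_PiM_iter:
  fixes h :: "(nat \<Rightarrow> 'a) \<Rightarrow> real"
  assumes [measurable]: "h \<in> borel_measurable S" and B: "\<And>\<omega>. \<bar>h \<omega>\<bar> \<le> B"
  shows "(\<integral>\<omega>. h \<omega> \<partial>S) = (\<integral>s. (\<integral>\<omega>. h (case_nat s \<omega>) \<partial>S) \<partial>M)"
proof -
  interpret MS: pair_prob_space M S by (rule pair_prob_space_PiM)
  have "(\<integral>\<omega>. h \<omega> \<partial>S) = (\<integral>p. h (case p of (s, \<omega>) \<Rightarrow> case_nat s \<omega>) \<partial>(M \<Otimes>\<^sub>M S))"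
    by (subst PiM_iter[symmetric], rule integral_distr) measurable
  also have "\<dots> = (\<integral>s. (\<integral>\<omega>. h (case_nat s \<omega>) \<partial>S) \<partial>M)"
  proof (subst MS.integral_fst'[symmetric])
    show "integrable (M \<Otimes>\<^sub>M S) (\<lambda>p. h (case p of (s, \<omega>) \<Rightarrow> case_nat s \<omega>))"
      by (rule MS.integrable_const_bound[where B = B]) (use B in auto)
  qed simp
  finally show ?thesis .
qed

lemma integrable_PiM_component:
  fixes f :: "'a \<Rightarrow> real"
  assumes "integrable M f"
  shows "integrable S (\<lambda>\<omega>. f (\<omega> i))"
proof -
  have "distr S M (\<lambda>\<omega>. \<omega> i) = M"
    by (rule distr_PiM_component) (auto intro: prob_space)
  with assms show ?thesis
    by (intro integrable_distr[of "\<lambda>\<omega>. \<omega> i" S M f]) auto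
qed

end

section \<open>Random walks with positive drift are bounded below\<close>

primrec running_min :: "('a \<Rightarrow> real) \<Rightarrow> nat \<Rightarrow> (nat \<Rightarrow> 'a) \<Rightarrow> real" where
  "running_min f 0 \<omega> = 0"
| "running_min f (Suc n) \<omega> = min (running_min f n \<omega>) (\<Sum>k<Suc n. f (\<omega> k))"

text \<open>Time 0 contributes 0, and every later partial sum is the first step plus a partial sum
  of the shifted walk.\<close>

lemma running_min_case_nat:
  "running_min f (Suc n) (case_nat s \<omega>) = min 0 (f s + running_min f n \<omega>)"
proof (induction n)
  case (Suc n)
  have "(\<Sum>k<Suc (Suc n). f (case_nat s \<omega> k)) = f s + (\<Sum>k<Suc n. f (\<omega> k))"
    by (subst sum.lessThan_Suc_shift) simp
  then show ?case
    by (subst running_min.simps(2), subst Suc.IH) (simp add: min_def)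
qed simp

lemma running_min_nonpos: "running_min f n \<omega> \<le> 0"
  by (induction n) auto

lemma running_min_antimono: "m \<le> n \<Longrightarrow> running_min f n \<omega> \<le> running_min f m \<omega>"
  by (rule lift_Suc_antimono_le[of "\<lambda>n. running_min f n \<omega>"]) auto

lemma running_min_le_sum: "running_min f n \<omega> \<le> (\<Sum>k<n. f (\<omega> k))"
  by (cases n) auto

lemma abs_running_min_le: "\<bar>running_min f n \<omega>\<bar> \<le> (\<Sum>k<n. \<bar>f (\<omega> k)\<bar>)"
proof (induction n)
  case (Suc n)
  have "\<bar>\<Sum>k<Suc n. f (\<omega> k)\<bar> \<le> (\<Sum>k<Suc n. \<bar>f (\<omega> k)\<bar>)"
    by (rule sum_abs)
  with Suc show ?case
    by (auto simp: min_def)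
qed simp

text \<open>
  Let \<open>m\<^sub>n\<close> be the running minimum and \<open>m'\<^sub>n\<close> that of the shifted walk, so that
  \<open>m\<^sub>n\<^sub>+\<^sub>1 = min 0 (\<xi>\<^sub>1 + m'\<^sub>n) = m'\<^sub>n + min (- m'\<^sub>n) \<xi>\<^sub>1\<close>.
  On the shift-invariant event that \<open>m\<^sub>n \<rightarrow> -\<infinity>\<close>, monotonicity of \<open>m\<^sub>n\<close> makes the integral of
  \<open>min (- m'\<^sub>n) \<xi>\<^sub>1\<close> nonpositive; it tends to \<open>E \<xi>\<^sub>1\<close> times the probability of the event, because
  the shifted event is independent of \<open>\<xi>\<^sub>1\<close>.
\<close>

lemma (in sequence_space) AE_partial_sums_bounded_below:
  fixes f :: "'a \<Rightarrow> real"
  assumes f: "integrable M f" and pos: "0 < (\<integral>s. f s \<partial>M)"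
  shows "AE \<omega> in S. \<exists>K::nat. \<forall>n. - real K \<le> (\<Sum>k<n. f (\<omega> k))"
proof -
  interpret MS: pair_prob_space M S by (rule pair_prob_space_PiM)
  have [measurable]: "f \<in> borel_measurable M" using f by auto
  have [measurable]: "running_min f n \<in> borel_measurable S" for n
    by (induction n) simp_all
  define unb where "unb \<omega> \<longleftrightarrow> (\<forall>K::nat. \<exists>n. running_min f n \<omega> < - real K)" for \<omega>
  have [measurable]: "Measurable.pred S unb"
    unfolding unb_def by measurable
  define e :: "(nat \<Rightarrow> 'a) \<Rightarrow> real" where "e \<omega> = (if unb \<omega> then 1 else 0)" for \<omega>
  have [measurable]: "e \<in> borel_measurable S"
    unfolding e_def by measurable
  \<comment> \<open>A prefixed step \<open>s\<close> moves the running minimum by at most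
    \<open>|f s|\<close>; widening the level \<open>K\<close> by a natural number \<open>N\<close>
    above \<open>|f s|\<close> absorbs this.\<close>
  have unb_shift: "unb (case_nat s \<omega>) \<longleftrightarrow> unb \<omega>" for s \<omega>
  proof -
    obtain N :: nat where N: "\<bar>f s\<bar> \<le> real N"
      using real_arch_simple by blast
    show ?thesis
    proof
      assume u: "unb (case_nat s \<omega>)"
      show "unb \<omega>" unfolding unb_def
      proof
        fix K :: nat
        obtain n where n: "running_min f n (case_nat s \<omega>) < - real (K + N)"
          using u unfolding unb_def by blast
        \<comment> \<open>The case \<open>n = 0\<close> is impossible because the running minimum
          starts at 0.\<close>
        then obtain m where "n = Suc m" by (cases n) auto
        with n have "min 0 (f s + running_min f m \<omega>) < - real (K + N)"
          by (simp only: running_min_case_nat)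
        then have "running_min f m \<omega> < - real K"
          using N by (simp add: min_def split: if_splits)
        then show "\<exists>n. running_min f n \<omega> < - real K" ..
      qed
    next
      assume u: "unb \<omega>"
      show "unb (case_nat s \<omega>)" unfolding unb_def
      proof
        fix K :: nat
        obtain n where "running_min f n \<omega> < - real (K + N)"
          using u unfolding unb_def by blast
        then have "running_min f (Suc n) (case_nat s \<omega>) < - real K"
          using N unfolding running_min_case_nat by (simp add: min_def) linarith
        then show "\<exists>n. running_min f n (case_nat s \<omega>) < - real K" ..
      qed
    qed
  qed
  have int_r: "integrable S (\<lambda>\<omega>. e \<omega> * running_min f n \<omega>)" for n
  proof (rule Bochner_Integration.integrable_bound)
    show "integrable S (\<lambda>\<omega>. \<Sum>k<n. \<bar>f (\<omega> k)\<bar>)"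
      using integrable_PiM_component[OF f] by (intro Bochner_Integration.integrable_sum integrable_abs)
    show "AE \<omega> in S. norm (e \<omega> * running_min f n \<omega>) \<le> norm (\<Sum>k<n. \<bar>f (\<omega> k)\<bar>)"
      using abs_running_min_le[of f n] by (intro AE_I2) (auto simp: e_def sum_nonneg)
  qed simp
  \<comment> \<open>\<open>g n\<close> is the difference of two successive minima, one for the
    prefixed walk and one for the shifted walk. It is bounded by \<open>|f|\<close> uniformly in
    \<open>n\<close>, as dominated convergence requires.\<close>
  define g where "g n = (\<lambda>p. e (snd p) * min (- running_min f n (snd p)) (f (fst p)))" for n
  have int_fst: "integrable (M \<Otimes>\<^sub>M S) (\<lambda>p. f (fst p))"
    using integrable_distr[of fst "M \<Otimes>\<^sub>M S" M f] f by (simp add: P.distr_pair_fst)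
  have [measurable]: "g n \<in> borel_measurable (M \<Otimes>\<^sub>M S)" for n
    unfolding g_def by measurable
  have gbound: "\<bar>g n p\<bar> \<le> \<bar>f (fst p)\<bar>" for n p
    using running_min_nonpos[of f n "snd p"] by (auto simp: g_def e_def min_def)
  have int_g: "integrable (M \<Otimes>\<^sub>M S) (g n)" for n
    by (rule Bochner_Integration.integrable_bound[OF int_fst]) (use gbound in auto)
  have int_snd: "integrable (M \<Otimes>\<^sub>M S) (\<lambda>p. e (snd p) * running_min f n (snd p))"
    and eq_snd: "(\<integral>p. e (snd p) * running_min f n (snd p) \<partial>(M \<Otimes>\<^sub>M S)) = (\<integral>\<omega>. e \<omega> * running_min f n \<omega> \<partial>S)" for n
  proof -
    \<comment> \<open>The second marginal is reduced to the first one by swapping the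
      factors.\<close>
    have "distr (M \<Otimes>\<^sub>M S) S snd = distr (S \<Otimes>\<^sub>M M) S fst"
      by (subst MS.distr_pair_swap, subst distr_distr) (auto simp: comp_def split_beta)
    also have "\<dots> = S"
      by (rule M.distr_pair_fst)
    finally have d: "distr (M \<Otimes>\<^sub>M S) S snd = S" .
    show "integrable (M \<Otimes>\<^sub>M S) (\<lambda>p. e (snd p) * running_min f n (snd p))"
      using integrable_distr[of snd "M \<Otimes>\<^sub>M S" S] int_r[of n] d by simp
    show "(\<integral>p. e (snd p) * running_min f n (snd p) \<partial>(M \<Otimes>\<^sub>M S)) = (\<integral>\<omega>. e \<omega> * running_min f n \<omega> \<partial>S)"
      by (subst d[symmetric], rule integral_distr[symmetric]) auto
  qed
  have le0: "(\<integral>p. g n p \<partial>(M \<Otimes>\<^sub>M S)) \<le> 0" for n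
  proof -
    have "(\<integral>\<omega>. e \<omega> * running_min f (Suc n) \<omega> \<partial>S)
        = (\<integral>p. e (snd p) * min 0 (f (fst p) + running_min f n (snd p)) \<partial>(M \<Otimes>\<^sub>M S))"
    proof -
      have "(\<integral>\<omega>. e \<omega> * running_min f (Suc n) \<omega> \<partial>S)
        = (\<integral>p. (\<lambda>\<omega>. e \<omega> * running_min f (Suc n) \<omega>) (case p of (s, \<omega>) \<Rightarrow> case_nat s \<omega>) \<partial>(M \<Otimes>\<^sub>M S))"
        by (subst (1) PiM_iter[symmetric], rule integral_distr) measurable
      also have "\<dots> = (\<integral>p. e (snd p) * min 0 (f (fst p) + running_min f n (snd p)) \<partial>(M \<Otimes>\<^sub>M S))"
        by (intro Bochner_Integration.integral_cong refl)
          (simp only: split_beta running_min_case_nat e_def unb_shift)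
      finally show ?thesis .
    qed
    also have "\<dots> = (\<integral>p. g n p + e (snd p) * running_min f n (snd p) \<partial>(M \<Otimes>\<^sub>M S))"
      by (intro Bochner_Integration.integral_cong refl) (auto simp: g_def e_def min_def)
    also have "\<dots> = (\<integral>p. g n p \<partial>(M \<Otimes>\<^sub>M S)) + (\<integral>\<omega>. e \<omega> * running_min f n \<omega> \<partial>S)"
      by (simp add: int_g int_snd eq_snd)
    finally have "(\<integral>p. g n p \<partial>(M \<Otimes>\<^sub>M S)) =
        (\<integral>\<omega>. e \<omega> * running_min f (Suc n) \<omega> \<partial>S) - (\<integral>\<omega>. e \<omega> * running_min f n \<omega> \<partial>S)"
      by simp
    moreover have "(\<integral>\<omega>. e \<omega> * running_min f (Suc n) \<omega> \<partial>S) \<le> (\<integral>\<omega>. e \<omega> * running_min f n \<omega> \<partial>S)"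
      by (rule integral_mono[OF int_r int_r]) (auto simp: e_def)
    ultimately show ?thesis by simp
  qed
  have "(\<lambda>n. \<integral>p. g n p \<partial>(M \<Otimes>\<^sub>M S)) \<longlonglongrightarrow> (\<integral>p. e (snd p) * f (fst p) \<partial>(M \<Otimes>\<^sub>M S))"
  proof (rule integral_dominated_convergence[where w = "\<lambda>p. \<bar>f (fst p)\<bar>"])
    show "AE p in M \<Otimes>\<^sub>M S. (\<lambda>n. g n p) \<longlonglongrightarrow> e (snd p) * f (fst p)"
    proof (rule AE_I2)
      fix p
      show "(\<lambda>n. g n p) \<longlonglongrightarrow> e (snd p) * f (fst p)"
      proof (cases "unb (snd p)")
        case True
        obtain K :: nat where K: "\<bar>f (fst p)\<bar> \<le> real K"
          using real_arch_simple by blast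
        obtain N where N: "running_min f N (snd p) < - real K"
          using True unfolding unb_def by blast
        \<comment> \<open>Once the running minimum is below \<open>- K\<close>, with
          \<open>K\<close> at least \<open>|f (fst p)|\<close>, the inner \<open>min\<close> always
          selects \<open>f (fst p)\<close>.\<close>
        have "g n p = e (snd p) * f (fst p)" if "n \<ge> N" for n
          using running_min_antimono[OF that, of f "snd p"] N K
          unfolding g_def by (intro arg_cong2[where f = "(*)"] min_absorb2 refl) linarith
        then have "eventually (\<lambda>n. g n p = e (snd p) * f (fst p)) sequentially"
          unfolding eventually_sequentially by blast
        then show ?thesis by (rule tendsto_eventually)
      qed (simp add: g_def e_def)
    qed
  qed (use int_fst gbound in auto)
  then have "(\<integral>p. e (snd p) * f (fst p) \<partial>(M \<Otimes>\<^sub>M S)) \<le> 0"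
    by (rule LIMSEQ_le_const2) (use le0 in auto)
  \<comment> \<open>Independence of the first step and the shifted event: the integral factors into
    the positive mean of \<open>f\<close> times the probability of \<open>unb\<close>, which must
    therefore vanish.\<close>
  also have "(\<integral>p. e (snd p) * f (fst p) \<partial>(M \<Otimes>\<^sub>M S)) = (\<integral>s. (\<integral>\<omega>. e \<omega> * f s \<partial>S) \<partial>M)"
  proof (subst MS.integral_fst'[symmetric])
    show "integrable (M \<Otimes>\<^sub>M S) (\<lambda>p. e (snd p) * f (fst p))"
      by (rule Bochner_Integration.integrable_bound[OF int_fst]) (auto simp: e_def)
  qed simp
  also have "\<dots> = (\<integral>s. f s \<partial>M) * (\<integral>\<omega>. e \<omega> \<partial>S)"
    by (simp add: mult.commute)
  finally have "(\<integral>\<omega>. e \<omega> \<partial>S) \<le> 0"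
    using pos by (simp add: mult_le_0_iff)
  moreover have "(\<integral>\<omega>. e \<omega> \<partial>S) \<ge> 0"
    by (rule integral_nonneg_AE) (simp add: e_def)
  ultimately have "(\<integral>\<omega>. e \<omega> \<partial>S) = 0" by simp
  moreover have "integrable S e"
    by (rule P.integrable_const_bound[where B = 1]) (auto simp: e_def)
  ultimately have "AE \<omega> in S. e \<omega> = 0"
    by (subst (asm) integral_nonneg_eq_0_iff_AE) (auto simp: e_def)
  then show ?thesis
  proof eventually_elim
    case (elim \<omega>)
    then obtain K :: nat where "\<And>n. - real K \<le> running_min f n \<omega>"
      by (auto simp: e_def unb_def not_less split: if_splits)
    then have "- real K \<le> (\<Sum>k<n. f (\<omega> k))" for n
      using running_min_le_sum[of f n \<omega>] order_trans by blast
    then show ?case by blast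
  qed
qed

section \<open>Products, series and orbits along a path of pairs\<close>

definition multiplier :: "nat \<Rightarrow> (nat \<Rightarrow> real \<times> real) \<Rightarrow> real" where
  "multiplier n \<omega> = (\<Prod>k<n. fst (\<omega> k))"

definition perp_term :: "nat \<Rightarrow> (nat \<Rightarrow> real \<times> real) \<Rightarrow> real" where
  "perp_term n \<omega> = snd (\<omega> n) * inverse (multiplier n \<omega>)"

definition perp_sum :: "nat \<Rightarrow> (nat \<Rightarrow> real \<times> real) \<Rightarrow> real" where
  "perp_sum n \<omega> = (\<Sum>k<n. perp_term k \<omega>)"

definition perpetuity :: "(nat \<Rightarrow> real \<times> real) \<Rightarrow> real" where
  "perpetuity \<omega> = (\<Sum>n. perp_term n \<omega>)"

text \<open>Closed form, for nonzero multipliers, of applying the maps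
  \<open>z -> fst (\<omega> k) * (z - snd (\<omega> k))\<close> to \<open>x\<close> in the order
  \<open>k = 0, 1, ..., n - 1\<close>.\<close>

definition orbit :: "nat \<Rightarrow> real \<Rightarrow> (nat \<Rightarrow> real \<times> real) \<Rightarrow> real" where
  "orbit n x \<omega> = multiplier n \<omega> * (x - perp_sum n \<omega>)"

lemma multiplier_case_nat: "multiplier (Suc n) (case_nat s \<omega>) = fst s * multiplier n \<omega>"
  unfolding multiplier_def by (subst prod.lessThan_Suc_shift) simp

lemma perp_term_case_nat_0: "perp_term 0 (case_nat s \<omega>) = snd s"
  by (simp add: perp_term_def multiplier_def)

lemma perp_term_case_nat_Suc:
  "perp_term (Suc n) (case_nat s \<omega>) = perp_term n \<omega> / fst s"
  by (simp add: perp_term_def multiplier_case_nat field_simps)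

lemma perp_sum_case_nat:
  "perp_sum (Suc n) (case_nat s \<omega>) = snd s + perp_sum n \<omega> / fst s"
  unfolding perp_sum_def
  by (subst sum.lessThan_Suc_shift)
     (simp add: perp_term_case_nat_0 perp_term_case_nat_Suc sum_divide_distrib)

text \<open>The distributional fixed-point relation of the series in pathwise form: the first term
  is split off and the common factor \<open>1 / fst s\<close> is taken out of the rest.\<close>

lemma perpetuity_case_nat:
  assumes "summable (\<lambda>n. perp_term n \<omega>)"
  shows "perpetuity (case_nat s \<omega>) = snd s + perpetuity \<omega> / fst s"
proof -
  have "(\<lambda>n. perp_term (Suc n) (case_nat s \<omega>)) sums (perpetuity \<omega> / fst s)"
    unfolding perp_term_case_nat_Suc perpetuity_def
    by (rule sums_divide[OF summable_sums[OF assms]])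
  then have "(\<lambda>n. perp_term n (case_nat s \<omega>)) sums (perpetuity \<omega> / fst s + perp_term 0 (case_nat s \<omega>))"
    by (subst (asm) sums_Suc_iff) simp
  then show ?thesis
    unfolding perpetuity_def perp_term_case_nat_0 by (simp add: sums_unique[symmetric] add.commute)
qed

lemma orbit_0: "orbit 0 x \<omega> = x"
  by (simp add: orbit_def multiplier_def perp_sum_def)

text \<open>The prefixed map acts first. It must be invertible because the closed form of the orbit
  divides by \<open>fst s\<close>.\<close>

lemma orbit_case_nat:
  assumes "fst s \<noteq> 0"
  shows "orbit (Suc n) x (case_nat s \<omega>) = orbit n (fst s * (x - snd s)) \<omega>"
  using assms by (simp add: orbit_def multiplier_case_nat perp_sum_case_nat field_simps)

lemma multiplier_nonzero: "(\<And>n. fst (\<omega> n) \<noteq> 0) \<Longrightarrow> multiplier n \<omega> \<noteq> 0"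
  by (simp add: multiplier_def)

lemma ln_abs_multiplier:
  assumes "\<And>n. fst (\<omega> n) \<noteq> 0"
  shows "ln \<bar>multiplier n \<omega>\<bar> = (\<Sum>k<n. ln \<bar>fst (\<omega> k)\<bar>)"
proof (induction n)
  case (Suc n)
  have "multiplier (Suc n) \<omega> = multiplier n \<omega> * fst (\<omega> n)"
    by (simp add: multiplier_def)
  with Suc show ?case
    using assms multiplier_nonzero[OF assms] by (simp add: abs_mult ln_mult)
qed (simp add: multiplier_def)

text \<open>At each point the excess is eventually 0, and \<open>|h|\<close> dominates it.\<close>

lemma integral_excess_tendsto_0:
  fixes h :: "'a \<Rightarrow> real"
  assumes "integrable M h"
  shows "(\<lambda>n::nat. \<integral>s. max 0 (h s - real n) \<partial>M) \<longlonglongrightarrow> 0"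
proof -
  have "(\<lambda>n::nat. \<integral>s. max 0 (h s - real n) \<partial>M) \<longlonglongrightarrow> (\<integral>s. 0 \<partial>M)"
  proof (rule integral_dominated_convergence[where w = "\<lambda>s. \<bar>h s\<bar>"])
    show "AE s in M. (\<lambda>n::nat. max 0 (h s - real n)) \<longlonglongrightarrow> 0"
    proof (rule AE_I2)
      fix s
      have "max 0 (h s - real n) = 0" if "n \<ge> nat \<lceil>h s\<rceil>" for n
        using that real_nat_ceiling_ge[of "h s"] by (simp add: max_def)
      then have "eventually (\<lambda>n. max 0 (h s - real n) = 0) sequentially"
        unfolding eventually_sequentially by blast
      then show "(\<lambda>n::nat. max 0 (h s - real n)) \<longlonglongrightarrow> 0"
        by (rule tendsto_eventually)
    qed
  qed (use assms in auto)
  then show ?thesis by simp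
qed

lemma measurable_fst_snd_real [measurable]:
  "fst \<in> borel_measurable (borel :: (real \<times> real) measure)"
  "snd \<in> borel_measurable (borel :: (real \<times> real) measure)"
  using measurable_fst[of "borel::real measure" "borel::real measure"]
    measurable_snd[of "borel::real measure" "borel::real measure"]
  by (simp_all add: borel_prod)

section \<open>Exponential growth, convergence of the series, and iteration of the equation\<close>

locale affine_recursion = sequence_space \<nu> for \<nu> :: "(real \<times> real) measure" +
  assumes sets_nu [measurable_cong]: "sets \<nu> = sets borel"
    and fst_nonzero: "AE s in \<nu>. fst s \<noteq> 0"
    and integrable_ln_fst: "integrable \<nu> (\<lambda>s. ln \<bar>fst s\<bar>)"
    and ln_fst_pos: "0 < (\<integral>s. ln \<bar>fst s\<bar> \<partial>\<nu>)"
    and integrable_ln_snd: "integrable \<nu> (\<lambda>s. ln (max \<bar>snd s\<bar> 1))"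
begin

lemma measurable_multiplier [measurable]: "multiplier n \<in> borel_measurable S"
  unfolding multiplier_def by measurable

lemma measurable_perp_term [measurable]: "perp_term n \<in> borel_measurable S"
  unfolding perp_term_def by measurable

lemma measurable_perp_sum [measurable]: "perp_sum n \<in> borel_measurable S"
  unfolding perp_sum_def by measurable

lemma measurable_perpetuity [measurable]: "perpetuity \<in> borel_measurable S"
  unfolding perpetuity_def by measurable

lemma measurable_orbit [measurable]: "orbit n x \<in> borel_measurable S"
  unfolding orbit_def by measurable

lemma AE_fst_nonzero: "AE \<omega> in S. \<forall>n. fst (\<omega> n) \<noteq> 0"
  unfolding AE_all_countable
  by (intro allI AE_PiM_component) (auto intro: prob_space fst_nonzero)

text \<open>Two walks with positive drift are bounded below: one has steps
  \<open>ln |fst s| - 2 * c\<close>, the other \<open>c\<close> minus the excess of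
  \<open>ln (max |snd s| 1)\<close> over a level \<open>R\<close>. The gap between the rates
  \<open>2 * c\<close> and \<open>c\<close> makes the series converge geometrically.\<close>

lemma AE_growth:
  "AE \<omega> in S. \<exists>c>0. \<exists>K. \<forall>n. exp (2 * c * real n - K) \<le> \<bar>multiplier n \<omega>\<bar>
      \<and> \<bar>snd (\<omega> n)\<bar> \<le> exp (c * real n + K)"
proof -
  define m where "m = (\<integral>s. ln \<bar>fst s\<bar> \<partial>\<nu>)"
  \<comment> \<open>With \<open>m = 4 * c\<close>, the first walk keeps drift
    \<open>2 * c\<close>.\<close>
  define c where "c = m / 4"
  define h where "h s = ln (max \<bar>snd s\<bar> 1)" for s :: "real \<times> real"
  have c: "c > 0" using ln_fst_pos by (simp add: c_def m_def)
  have h: "integrable \<nu> h" unfolding h_def by (rule integrable_ln_snd)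
  txt \<open>Truncating at a high level \<open>R\<close> makes the mean excess of \<open>ln (max |\<beta>| 1)\<close> over
    \<open>R\<close> as small as needed, so that \<open>|\<beta>\<^sub>n|\<close> grows at a smaller exponential rate than \<open>|A\<^sub>n|\<close>.\<close>
  obtain R :: nat where R: "(\<integral>s. max 0 (h s - real R) \<partial>\<nu>) < c"
    using order_tendstoD(2)[OF integral_excess_tendsto_0[OF h] c]
    by (auto simp: eventually_sequentially)
  have int_ex: "integrable \<nu> (\<lambda>s. max 0 (h s - real R))"
    using h by (intro integrable_max) auto
  have "AE \<omega> in S. \<exists>K::nat. \<forall>n. - real K \<le> (\<Sum>k<n. ln \<bar>fst (\<omega> k)\<bar> - 2 * c)"
    by (rule AE_partial_sums_bounded_below[where f = "\<lambda>s. ln \<bar>fst s\<bar> - 2 * c"])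
       (use integrable_ln_fst ln_fst_pos in \<open>auto simp: c_def m_def M.prob_space\<close>)
  moreover have "AE \<omega> in S. \<exists>K::nat. \<forall>n. - real K \<le> (\<Sum>k<n. c - max 0 (h (\<omega> k) - real R))"
    by (rule AE_partial_sums_bounded_below[where f = "\<lambda>s. c - max 0 (h s - real R)"])
       (use int_ex R in \<open>auto simp: M.prob_space\<close>)
  ultimately show ?thesis
    using AE_fst_nonzero
  proof eventually_elim
    case (elim \<omega>)
    then have nz: "\<And>n. fst (\<omega> n) \<noteq> 0" by blast
    obtain K1 :: nat where K1: "\<And>n. - real K1 \<le> (\<Sum>k<n. ln \<bar>fst (\<omega> k)\<bar> - 2 * c)"
      using elim by blast
    obtain K2 :: nat where K2: "\<And>n. - real K2 \<le> (\<Sum>k<n. c - max 0 (h (\<omega> k) - real R))"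
      using elim by blast
    \<comment> \<open>The summand \<open>c\<close> pays for the bound on coordinate
      \<open>n\<close>, which uses the walk at time \<open>Suc n\<close>.\<close>
    define K where "K = real K1 + real K2 + real R + c"
    have "exp (2 * c * real n - K) \<le> \<bar>multiplier n \<omega>\<bar>
      \<and> \<bar>snd (\<omega> n)\<bar> \<le> exp (c * real n + K)" for n
    proof
      have "2 * c * real n - K \<le> ln \<bar>multiplier n \<omega>\<bar>"
        using K1[of n] c by (simp add: ln_abs_multiplier[OF nz] sum_subtractf K_def mult.commute)
      then have "exp (2 * c * real n - K) \<le> exp (ln \<bar>multiplier n \<omega>\<bar>)"
        by simp
      then show "exp (2 * c * real n - K) \<le> \<bar>multiplier n \<omega>\<bar>"
        using multiplier_nonzero[OF nz] by simp
      \<comment> \<open>A single excess is at most the sum of all excesses so far, since they are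
        nonnegative.\<close>
      have "h (\<omega> n) - real R \<le> (\<Sum>k<Suc n. max 0 (h (\<omega> k) - real R))"
        by (rule order_trans[OF _ member_le_sum[of n]]) auto
      also have "\<dots> \<le> c * real (Suc n) + real K2"
        using K2[of "Suc n"] unfolding sum_subtractf by (simp add: mult.commute)
      finally have "h (\<omega> n) \<le> c * real n + K"
        by (simp add: K_def algebra_simps)
      then have "exp (h (\<omega> n)) \<le> exp (c * real n + K)" by simp
      then show "\<bar>snd (\<omega> n)\<bar> \<le> exp (c * real n + K)"
        by (simp add: h_def)
    qed
    with c show ?case by blast
  qed
qed

lemma AE_summable: "AE \<omega> in S. summable (\<lambda>n. perp_term n \<omega>)"
  using AE_growth
proof eventually_elim
  case (elim \<omega>)
  then obtain c K where c: "c > 0"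
    and A: "\<And>n. exp (2 * c * real n - K) \<le> \<bar>multiplier n \<omega>\<bar>"
    and B: "\<And>n. \<bar>snd (\<omega> n)\<bar> \<le> exp (c * real n + K)"
    by blast
  show ?case
  proof (rule summable_comparison_test')
    show "summable (\<lambda>n. exp (2 * K) * exp (- c) ^ n)"
      using c by (intro summable_mult summable_geometric) simp
    fix n
    have "norm (perp_term n \<omega>) = \<bar>snd (\<omega> n)\<bar> / \<bar>multiplier n \<omega>\<bar>"
      by (simp add: perp_term_def abs_mult divide_inverse)
    also have "\<dots> \<le> exp (c * real n + K) / exp (2 * c * real n - K)"
      by (intro frac_le A B) auto
    also have "\<dots> = exp (2 * K) * exp (- c) ^ n"
      by (simp add: exp_diff[symmetric] exp_of_nat_mult[symmetric] exp_add[symmetric] algebra_simps)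
    finally show "norm (perp_term n \<omega>) \<le> exp (2 * K) * exp (- c) ^ n" .
  qed
qed

lemma AE_multiplier_at_top: "AE \<omega> in S. filterlim (\<lambda>n. \<bar>multiplier n \<omega>\<bar>) at_top sequentially"
  using AE_growth
proof eventually_elim
  case (elim \<omega>)
  then obtain c K where c: "c > 0"
    and A: "\<And>n. exp (2 * c * real n - K) \<le> \<bar>multiplier n \<omega>\<bar>"
    by blast
  have "filterlim (\<lambda>n. exp (2 * c * real n - K)) at_top sequentially"
  proof (rule filterlim_compose[OF exp_at_top])
    have "filterlim (\<lambda>n. - K + 2 * c * real n) at_top sequentially"
      using c by (intro filterlim_tendsto_add_at_top[OF tendsto_const]
          filterlim_tendsto_pos_mult_at_top[OF tendsto_const] filterlim_real_sequentially) auto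
    then show "filterlim (\<lambda>n. 2 * c * real n - K) at_top sequentially"
      by (simp add: algebra_simps)
  qed
  then show ?case
    by (rule filterlim_at_top_mono) (use A in auto)
qed

text \<open>Induction on \<open>n\<close> by splitting off the first coordinate; \<open>x\<close> is
  arbitrary because the first map moves the starting point.\<close>

lemma integral_orbit:
  fixes y :: "real \<Rightarrow> real"
  assumes [measurable]: "y \<in> borel_measurable borel" and B: "\<And>x. \<bar>y x\<bar> \<le> B"
    and sol: "\<And>x. y x = (\<integral>s. y (fst s * (x - snd s)) \<partial>\<nu>)"
  shows "(\<integral>\<omega>. y (orbit n x \<omega>) \<partial>S) = y x"
proof (induction n arbitrary: x)
  case 0
  then show ?case by (simp add: orbit_0 P.prob_space)
next
  case (Suc n)
  have "(\<integral>\<omega>. y (orbit (Suc n) x \<omega>) \<partial>S)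
      = (\<integral>s. (\<integral>\<omega>. y (orbit (Suc n) x (case_nat s \<omega>)) \<partial>S) \<partial>\<nu>)"
    by (rule integral_PiM_iter) (use B in auto)
  also have "\<dots> = (\<integral>s. y (fst s * (x - snd s)) \<partial>\<nu>)"
  proof (rule integral_cong_AE)
    show "(\<lambda>s. \<integral>\<omega>. y (orbit (Suc n) x (case_nat s \<omega>)) \<partial>S) \<in> borel_measurable \<nu>"
      by measurable
    show "AE s in \<nu>. (\<integral>\<omega>. y (orbit (Suc n) x (case_nat s \<omega>)) \<partial>S) = y (fst s * (x - snd s))"
      using fst_nonzero by eventually_elim (simp add: orbit_case_nat Suc.IH)
  qed measurable
  finally show ?case using sol[of x] by simp
qed

end

section \<open>The law of the series has no atoms\<close>

lemma affine_permutation_of_finite_set: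
  fixes D :: "real set"
  assumes "finite D" and "a \<noteq> 0" and map: "\<And>x. x \<in> D \<Longrightarrow> a * (x - b) \<in> D"
    and "u \<in> D" "v \<in> D" "u \<noteq> v"
  shows "\<bar>a\<bar> = 1"
proof -
  let ?f = "\<lambda>x. a * (x - b)"
  txt \<open>The map permutes \<open>D\<close> and scales all distances by \<open>|a|\<close>, so the sum of all pairwise
    distances is multiplied by \<open>|a|\<close> and yet unchanged.\<close>
  define W where "W = (\<Sum>x\<in>D. \<Sum>z\<in>D. \<bar>x - z\<bar>)"
  have inj: "inj_on ?f D" using \<open>a \<noteq> 0\<close> by (auto simp: inj_on_def)
  have img: "?f ` D = D"
    by (rule endo_inj_surj[OF \<open>finite D\<close> _ inj]) (use map in auto)
  have "W = (\<Sum>x\<in>?f ` D. \<Sum>z\<in>?f ` D. \<bar>x - z\<bar>)"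
    unfolding W_def img ..
  also have "\<dots> = (\<Sum>x\<in>D. \<Sum>z\<in>D. \<bar>?f x - ?f z\<bar>)"
    by (simp add: sum.reindex[OF inj])
  also have "\<dots> = (\<Sum>x\<in>D. \<Sum>z\<in>D. \<bar>a\<bar> * \<bar>x - z\<bar>)"
    by (intro sum.cong refl) (simp add: abs_mult[symmetric] algebra_simps)
  also have "\<dots> = \<bar>a\<bar> * W"
    by (simp add: W_def sum_distrib_left)
  finally have W: "W = \<bar>a\<bar> * W" .
  have "0 < \<bar>u - v\<bar>" using \<open>u \<noteq> v\<close> by simp
  also have "\<dots> \<le> (\<Sum>z\<in>D. \<bar>u - z\<bar>)"
    by (rule member_le_sum) (use assms in auto)
  also have "\<dots> \<le> W"
    unfolding W_def by (rule member_le_sum[where i = u and f = "\<lambda>x. \<Sum>z\<in>D. \<bar>x - z\<bar>"])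
      (use assms in \<open>auto intro: sum_nonneg\<close>)
  finally show ?thesis using W by simp
qed

text \<open>More than \<open>1 / e\<close> disjoint events of probability at least \<open>e\<close>
  would have total probability above 1.\<close>

lemma (in prob_space) finite_heavy_points:
  assumes [measurable]: "X \<in> borel_measurable M" and "e > 0"
  shows "finite {x::real. e \<le> prob {\<omega> \<in> space M. X \<omega> = x}}"
proof (rule ccontr)
  let ?E = "\<lambda>x. {\<omega> \<in> space M. X \<omega> = x}"
  assume "infinite {x. e \<le> prob (?E x)}"
  then obtain F where F: "F \<subseteq> {x. e \<le> prob (?E x)}" "finite F" "card F = nat \<lceil>1 / e\<rceil> + 1"
    using infinite_arbitrarily_large by blast
  have "real (card F) * e \<le> (\<Sum>x\<in>F. prob (?E x))"
    using F(1) by (intro sum_bounded_below) auto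
  also have "\<dots> = prob (\<Union>x\<in>F. ?E x)"
    by (rule finite_measure_finite_Union[symmetric]) (use F in \<open>auto simp: disjoint_family_on_def\<close>)
  also have "\<dots> \<le> 1" by simp
  finally have "real (card F) \<le> 1 / e" using \<open>e > 0\<close> by (simp add: field_simps)
  moreover have "1 / e < real (card F)"
    using real_nat_ceiling_ge[of "1 / e"] F(3) by simp
  ultimately show False by simp
qed

context affine_recursion
begin

definition atom :: "real \<Rightarrow> real" where
  "atom x = P.prob {\<omega> \<in> space S. perpetuity \<omega> = x}"

lemma atom_eq_integral: "atom x = (\<integral>\<omega>. indicat_real {x} (perpetuity \<omega>) \<partial>S)"
proof -
  have "(\<integral>\<omega>. indicat_real {x} (perpetuity \<omega>) \<partial>S)
      = (\<integral>\<omega>. indicat_real {\<omega> \<in> space S. perpetuity \<omega> = x} \<omega> \<partial>S)"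
    by (intro Bochner_Integration.integral_cong) (auto simp: indicator_def)
  then show ?thesis by (simp add: atom_def)
qed

text \<open>By \<open>perpetuity_case_nat\<close>, the prefixed path has sum \<open>x\<close>
  exactly when the original path has sum \<open>fst s * (x - snd s)\<close>.\<close>

lemma atom_invariant: "atom x = (\<integral>s. atom (fst s * (x - snd s)) \<partial>\<nu>)"
proof -
  have "atom x = (\<integral>s. (\<integral>\<omega>. indicat_real {x} (perpetuity (case_nat s \<omega>)) \<partial>S) \<partial>\<nu>)"
    unfolding atom_eq_integral by (rule integral_PiM_iter[where B = 1]) (auto simp: indicator_def)
  also have "\<dots> = (\<integral>s. (\<integral>\<omega>. indicat_real {fst s * (x - snd s)} (perpetuity \<omega>) \<partial>S) \<partial>\<nu>)"
  proof (rule integral_cong_AE)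
    show "AE s in \<nu>. (\<integral>\<omega>. indicat_real {x} (perpetuity (case_nat s \<omega>)) \<partial>S)
        = (\<integral>\<omega>. indicat_real {fst s * (x - snd s)} (perpetuity \<omega>) \<partial>S)"
      using fst_nonzero AE_space
    proof eventually_elim
      case (elim s)
      show ?case
      proof (rule integral_cong_AE)
        show "AE \<omega> in S. indicat_real {x} (perpetuity (case_nat s \<omega>))
            = indicat_real {fst s * (x - snd s)} (perpetuity \<omega>)"
          using AE_summable
        proof eventually_elim
          case (elim \<omega>)
          then show ?case
            using \<open>fst s \<noteq> 0\<close> by (auto simp: perpetuity_case_nat indicator_def field_simps)
        qed
      qed (use elim in measurable)
    qed
  next
    \<comment> \<open>Joint measurability makes the inner integral measurable in
      \<open>s\<close>.\<close>
    have "(\<lambda>p. (indicat_real {x} (perpetuity (case p of (s, \<omega>) \<Rightarrow> case_nat s \<omega>)) :: real)) \<in> borel_measurable (\<nu> \<Otimes>\<^sub>M S)"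
      by measurable
    then show "(\<lambda>s. \<integral>\<omega>. indicat_real {x} (perpetuity (case_nat s \<omega>)) \<partial>S) \<in> borel_measurable \<nu>"
      by (intro P.borel_measurable_lebesgue_integral) (simp add: split_beta)
    have "(\<lambda>p. (if perpetuity (snd p) = fst (fst p) * (x - snd (fst p)) then 1 else 0 :: real)) \<in> borel_measurable (\<nu> \<Otimes>\<^sub>M S)"
      by measurable
    then show "(\<lambda>s. \<integral>\<omega>. indicat_real {fst s * (x - snd s)} (perpetuity \<omega>) \<partial>S) \<in> borel_measurable \<nu>"
      by (intro P.borel_measurable_lebesgue_integral) (simp add: split_beta indicator_def)
  qed
  also have "\<dots> = (\<integral>s. atom (fst s * (x - snd s)) \<partial>\<nu>)"
    by (simp add: atom_eq_integral)
  finally show ?thesis .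
qed

lemma measurable_atom [measurable]: "atom \<in> borel_measurable borel"
proof -
  have "(\<lambda>p. if perpetuity (snd p) = fst p then 1 else 0 :: real) \<in> borel_measurable (borel \<Otimes>\<^sub>M S)"
    by measurable
  then show ?thesis
    unfolding atom_eq_integral[abs_def] indicator_def
    by (intro P.borel_measurable_lebesgue_integral) (simp add: split_beta)
qed

lemma atom_eq_0:
  assumes not_isometric: "\<not> (AE s in \<nu>. \<bar>fst s\<bar> = 1)"
    and no_fixpoint: "\<And>c. \<not> (AE s in \<nu>. fst s * (c - snd s) = c)"
  shows "atom x = 0"
proof (rule ccontr)
  assume "atom x \<noteq> 0"
  then have pos: "atom x > 0" by (simp add: atom_def zero_less_measure_iff)
  define H where "H = {z. atom x \<le> atom z}"
  have "finite H"
    unfolding H_def atom_def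
    by (rule P.finite_heavy_points) (use pos in \<open>auto simp: atom_def\<close>)
  have "x \<in> H" by (simp add: H_def)
  have "Max (atom ` H) \<in> atom ` H"
    by (rule Max_in) (use \<open>finite H\<close> \<open>x \<in> H\<close> in auto)
  \<comment> \<open>Finiteness of \<open>H\<close> makes the maximum attained. It is global, since
    outside \<open>H\<close> the value is below \<open>atom x\<close>.\<close>
  then obtain t where t: "t \<in> H" "atom t = Max (atom ` H)" by auto
  define D where "D = {z. atom z = atom t}"
  have max: "atom z \<le> atom t" for z
  proof (cases "z \<in> H")
    case True
    then show ?thesis using \<open>finite H\<close> t(2) by simp
  next
    case False
    then show ?thesis using t(1) by (simp add: H_def)
  qed
  have "D \<subseteq> H" using t(1) by (auto simp: D_def H_def)
  with \<open>finite H\<close> have finD: "finite D" by (rule rev_finite_subset)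
  have tD: "t \<in> D" by (simp add: D_def)
  have inv: "AE s in \<nu>. fst s * (z - snd s) \<in> D" if "z \<in> D" for z
  proof -
    have bnd: "\<bar>atom v\<bar> \<le> 1" for v by (simp add: atom_def)
    have int: "integrable \<nu> (\<lambda>s. atom (fst s * (z - snd s)))"
      by (rule M.integrable_const_bound[where B = 1]) (use bnd in auto)
    \<comment> \<open>The integrand is nonnegative by maximality, so a zero integral forces the
      image of \<open>z\<close> to be a maximiser almost surely.\<close>
    have "(\<integral>s. atom t - atom (fst s * (z - snd s)) \<partial>\<nu>) = atom t - atom z"
      using int atom_invariant[of z] by (simp add: M.prob_space)
    also have "\<dots> = 0" using that by (simp add: D_def)
    finally have "AE s in \<nu>. atom t - atom (fst s * (z - snd s)) = 0"
      by (subst (asm) integral_nonneg_eq_0_iff_AE) (use int max in auto)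
    then show ?thesis by eventually_elim (simp add: D_def)
  qed
  have inv_all: "AE s in \<nu>. \<forall>z\<in>D. fst s * (z - snd s) \<in> D"
    by (rule AE_finite_allI[OF finD inv])
  show False
  \<comment> \<open>A single maximiser would be an almost sure fixed point; two of them force
    \<open>|fst s| = 1\<close>.\<close>
  proof (cases "D = {t}")
    case True
    with inv[OF tD] no_fixpoint[of t] show False by simp
  next
    case False
    with tD obtain u where "u \<in> D" "u \<noteq> t" by blast
    have "AE s in \<nu>. \<bar>fst s\<bar> = 1"
      using inv_all fst_nonzero
      by eventually_elim (use affine_permutation_of_finite_set[OF finD] \<open>u \<in> D\<close> \<open>u \<noteq> t\<close> tD in blast)
    with not_isometric show False by simp
  qed
qed

end

section \<open>Solutions with limits at both ends\<close>

locale nondegenerate_affine_recursion = affine_recursion +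
  assumes not_isometric: "\<not> (AE s in \<nu>. \<bar>fst s\<bar> = 1)"
    and no_fixpoint: "\<And>c. \<not> (AE s in \<nu>. fst s * (c - snd s) = c)"
begin

lemma AE_perpetuity_neq: "AE \<omega> in S. perpetuity \<omega> \<noteq> x"
  using atom_eq_0[OF not_isometric no_fixpoint, of x] unfolding atom_def
  by (subst (asm) P.prob_eq_0) auto

lemma continuous_cdf_perpetuity: "continuous_on UNIV (cdf (distr S borel perpetuity))"
proof -
  interpret D: real_distribution "distr S borel perpetuity"
    by (simp add: P.real_distribution_distr)
  have "measure (distr S borel perpetuity) {x} = 0" for x
    using atom_eq_0[OF not_isometric no_fixpoint, of x]
    by (simp add: measure_distr atom_def vimage_def Int_def conj_commute)
  then show ?thesis
    by (simp add: continuous_on_eq_continuous_at D.isCont_cdf)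
qed

text \<open>With equal limits only the divergence of \<open>|orbit n x \<omega>|\<close> matters, so
  the multipliers may change sign.\<close>

lemma solution_constant:
  fixes y :: "real \<Rightarrow> real"
  assumes y [measurable]: "y \<in> borel_measurable borel" and B: "\<And>x. \<bar>y x\<bar> \<le> B"
    and sol: "\<And>x. y x = (\<integral>s. y (fst s * (x - snd s)) \<partial>\<nu>)"
    and lim: "(y \<longlongrightarrow> L) at_top" "(y \<longlongrightarrow> L) at_bot"
  shows "y x = L"
proof -
  have "(\<lambda>n. \<integral>\<omega>. y (orbit n x \<omega>) \<partial>S) \<longlonglongrightarrow> (\<integral>\<omega>. L \<partial>S)"
  proof (rule integral_dominated_convergence[where w = "\<lambda>_. B"])
    show "AE \<omega> in S. (\<lambda>n. y (orbit n x \<omega>)) \<longlonglongrightarrow> L"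
      using AE_multiplier_at_top AE_summable AE_perpetuity_neq[of x]
    proof eventually_elim
      case (elim \<omega>)
      have ps: "(\<lambda>n. perp_sum n \<omega>) \<longlonglongrightarrow> perpetuity \<omega>"
        unfolding perp_sum_def perpetuity_def by (rule summable_LIMSEQ[OF elim(2)])
      \<comment> \<open>The first factor has a positive limit because
        \<open>perpetuity \<omega>\<close> differs from \<open>x\<close>.\<close>
      have "filterlim (\<lambda>n. \<bar>x - perp_sum n \<omega>\<bar> * \<bar>multiplier n \<omega>\<bar>) at_top sequentially"
        by (rule filterlim_tendsto_pos_mult_at_top[OF _ _ elim(1)])
           (use elim in \<open>auto intro!: tendsto_intros ps\<close>)
      then have "filterlim (\<lambda>n. norm (orbit n x \<omega>)) at_top sequentially"
        by (simp add: orbit_def abs_mult mult.commute)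
      then have "filterlim (\<lambda>n. orbit n x \<omega>) at_infinity sequentially"
        by (rule filterlim_norm_at_top_imp_at_infinity)
      moreover have "(y \<longlongrightarrow> L) at_infinity"
        using lim by (simp add: at_infinity_eq_at_top_bot filterlim_sup)
      ultimately show ?case by (rule filterlim_compose[rotated])
    qed
  qed (use B in auto)
  then have "(\<lambda>n. y x) \<longlonglongrightarrow> L"
    using integral_orbit[OF y B sol] by (simp add: P.prob_space)
  then show ?thesis by (simp add: LIMSEQ_const_iff)
qed

text \<open>Along almost every path the limit is \<open>Lp\<close> or \<open>Lm\<close> according to
  the sign of \<open>x - perpetuity \<omega>\<close>; integrating this two-valued limit produces the
  distribution function.\<close>

lemma solution_eq_cdf_perpetuity:
  fixes y :: "real \<Rightarrow> real"
  assumes y [measurable]: "y \<in> borel_measurable borel" and B: "\<And>x. \<bar>y x\<bar> \<le> B"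
    and sol: "\<And>x. y x = (\<integral>s. y (fst s * (x - snd s)) \<partial>\<nu>)"
    and lim: "(y \<longlongrightarrow> Lp) at_top" "(y \<longlongrightarrow> Lm) at_bot"
    and pos: "AE s in \<nu>. fst s > 0"
  shows "y x = (Lp - Lm) * cdf (distr S borel perpetuity) x + Lm"
proof -
  have pos_all: "AE \<omega> in S. \<forall>n. fst (\<omega> n) > 0"
    unfolding AE_all_countable
    by (intro allI AE_PiM_component) (auto intro: prob_space pos)
  have "(\<lambda>n. \<integral>\<omega>. y (orbit n x \<omega>) \<partial>S) \<longlonglongrightarrow> (\<integral>\<omega>. (Lp - Lm) * indicat_real {..x} (perpetuity \<omega>) + Lm \<partial>S)"
  proof (rule integral_dominated_convergence[where w = "\<lambda>_. B"])
    show "AE \<omega> in S. (\<lambda>n. y (orbit n x \<omega>)) \<longlonglongrightarrow> (Lp - Lm) * indicat_real {..x} (perpetuity \<omega>) + Lm"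
      using AE_multiplier_at_top AE_summable AE_perpetuity_neq[of x] pos_all
    proof eventually_elim
      case (elim \<omega>)
      have ps: "(\<lambda>n. perp_sum n \<omega>) \<longlonglongrightarrow> perpetuity \<omega>"
        unfolding perp_sum_def perpetuity_def by (rule summable_LIMSEQ[OF elim(2)])
      have "multiplier n \<omega> > 0" for n using elim(4) by (simp add: multiplier_def prod_pos)
      then have A: "filterlim (\<lambda>n. multiplier n \<omega>) at_top sequentially"
        using elim(1) by (simp add: abs_of_pos)
      have d: "(\<lambda>n. x - perp_sum n \<omega>) \<longlonglongrightarrow> x - perpetuity \<omega>"
        by (intro tendsto_intros ps)
      show ?case
      proof (cases "perpetuity \<omega> < x")
        case True
        have "filterlim (\<lambda>n. orbit n x \<omega>) at_top sequentially"
          using filterlim_tendsto_pos_mult_at_top[OF d _ A] True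
          by (simp add: orbit_def mult.commute)
        from filterlim_compose[OF lim(1) this] True show ?thesis
          by (simp add: indicator_def)
      next
        case False
        with elim(3) have gt: "x < perpetuity \<omega>" by simp
        have "filterlim (\<lambda>n. orbit n x \<omega>) at_bot sequentially"
          using filterlim_tendsto_neg_mult_at_bot[OF d _ A] gt
          by (simp add: orbit_def mult.commute)
        from filterlim_compose[OF lim(2) this] gt show ?thesis
          by (simp add: indicator_def)
      qed
    qed
  qed (use B in auto)
  moreover have "(\<integral>\<omega>. (Lp - Lm) * indicat_real {..x} (perpetuity \<omega>) + Lm \<partial>S)
      = (Lp - Lm) * cdf (distr S borel perpetuity) x + Lm"
  proof -
    have int: "integrable S (\<lambda>\<omega>. indicat_real {..x} (perpetuity \<omega>))"
      by (rule P.integrable_const_bound[where B = 1]) (auto simp: indicator_def)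
    have "(\<integral>\<omega>. indicat_real {..x} (perpetuity \<omega>) \<partial>S) = (\<integral>u. indicat_real {..x} u \<partial>distr S borel perpetuity)"
      by (rule integral_distr[symmetric]) auto
    also have "\<dots> = cdf (distr S borel perpetuity) x"
      by (simp add: cdf_def)
    finally show ?thesis using int by (simp add: P.prob_space)
  qed
  ultimately have "(\<lambda>n. y x) \<longlonglongrightarrow> (Lp - Lm) * cdf (distr S borel perpetuity) x + Lm"
    using integral_orbit[OF y B sol] by simp
  then show ?thesis by (simp add: LIMSEQ_const_iff)
qed

text \<open>Along integers \<open>x = n\<close> the equation yields
  \<open>Lp = p * Lp + (1 - p) * Lm\<close>, where \<open>p < 1\<close> is the probability of
  \<open>fst s > 0\<close>.\<close>

lemma limits_eq_if_negative:
  fixes y :: "real \<Rightarrow> real"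
  assumes y [measurable]: "y \<in> borel_measurable borel" and B: "\<And>x. \<bar>y x\<bar> \<le> B"
    and sol: "\<And>x. y x = (\<integral>s. y (fst s * (x - snd s)) \<partial>\<nu>)"
    and lim: "(y \<longlongrightarrow> Lp) at_top" "(y \<longlongrightarrow> Lm) at_bot"
    and neg: "\<not> (AE s in \<nu>. fst s > 0)"
  shows "Lp = Lm"
proof -
  have "(\<lambda>n::nat. \<integral>s. y (fst s * (real n - snd s)) \<partial>\<nu>)
      \<longlonglongrightarrow> (\<integral>s. (Lp - Lm) * indicat_real {0<..} (fst s) + Lm \<partial>\<nu>)"
  proof (rule integral_dominated_convergence[where w = "\<lambda>_. B"])
    show "AE s in \<nu>. (\<lambda>n. y (fst s * (real n - snd s))) \<longlonglongrightarrow> (Lp - Lm) * indicat_real {0<..} (fst s) + Lm"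
      using fst_nonzero
    proof eventually_elim
      case (elim s)
      have t: "filterlim (\<lambda>n. real n - snd s) at_top sequentially"
        using filterlim_tendsto_add_at_top[OF tendsto_const[of "- snd s"] filterlim_real_sequentially]
        by simp
      show ?case
      proof (cases "fst s > 0")
        case True
        from filterlim_compose[OF lim(1) filterlim_tendsto_pos_mult_at_top[OF tendsto_const True t]] True
        show ?thesis by simp
      next
        case False
        with elim have neg: "fst s < 0" by simp
        from filterlim_compose[OF lim(2) filterlim_tendsto_neg_mult_at_bot[OF tendsto_const neg t]] neg
        show ?thesis by simp
      qed
    qed
  qed (use B in auto)
  moreover have "(\<lambda>n::nat. \<integral>s. y (fst s * (real n - snd s)) \<partial>\<nu>) \<longlonglongrightarrow> Lp"
    unfolding sol[symmetric] by (rule filterlim_compose[OF lim(1) filterlim_real_sequentially])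
  ultimately have "Lp = (\<integral>s. (Lp - Lm) * indicat_real {0<..} (fst s) + Lm \<partial>\<nu>)"
    using LIMSEQ_unique by blast
  also have "\<dots> = (Lp - Lm) * (\<integral>s. indicat_real {0<..} (fst s) \<partial>\<nu>) + Lm"
  proof -
    have "integrable \<nu> (\<lambda>s. indicat_real {0<..} (fst s))"
      by (rule M.integrable_const_bound[where B = 1]) (auto simp: indicator_def)
    then show ?thesis by (simp add: M.prob_space)
  qed
  also have "(\<integral>s. indicat_real {0<..} (fst s) \<partial>\<nu>) = M.prob {s \<in> space \<nu>. fst s > 0}"
  proof -
    have "(\<integral>s. indicat_real {0<..} (fst s) \<partial>\<nu>) = (\<integral>s. indicat_real {s \<in> space \<nu>. fst s > 0} s \<partial>\<nu>)"
      by (intro Bochner_Integration.integral_cong) (auto simp: indicator_def)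
    then show ?thesis by simp
  qed
  finally have "(Lp - Lm) * (1 - M.prob {s \<in> space \<nu>. fst s > 0}) = 0"
    by (simp add: algebra_simps)
  moreover have "M.prob {s \<in> space \<nu>. fst s > 0} \<noteq> 1"
    using neg by (subst M.prob_Collect_eq_1) auto
  ultimately show ?thesis by simp
qed

end

section \<open>Transfer between arbitrary i.i.d. copies and the product space\<close>

lemma iid_copies_sequence:
  assumes iid: "iid_copies M \<alpha> \<beta> N a b"
    and [measurable]: "\<alpha> \<in> borel_measurable M" "\<beta> \<in> borel_measurable M"
    and "prob_space M"
  defines "\<nu> \<equiv> distr M borel (\<lambda>\<omega>. (\<alpha> \<omega>, \<beta> \<omega>))"
  defines "T \<equiv> \<lambda>\<omega> n. (a (Suc n) \<omega>, b (Suc n) \<omega>)"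
  shows "T \<in> measurable N (\<Pi>\<^sub>M i\<in>UNIV::nat set. \<nu>)"
    and "distr N (\<Pi>\<^sub>M i\<in>UNIV::nat set. \<nu>) T = (\<Pi>\<^sub>M i\<in>UNIV::nat set. \<nu>)"
proof -
  define X where "X = (\<lambda>n \<omega>. (a n \<omega>, b n \<omega>))"
  interpret N: prob_space N using iid by (simp add: iid_copies_def)
  have rv: "X n \<in> borel_measurable N" if "n \<ge> 1" for n
    using iid that unfolding iid_copies_def N.indep_vars_def X_def by auto
  have [measurable_cong]: "sets \<nu> = sets borel" and space_nu: "space \<nu> = UNIV"
    by (simp_all add: \<nu>_def)
  have prob: "prob_space \<nu>"
    unfolding \<nu>_def by (rule prob_space.prob_space_distr[OF \<open>prob_space M\<close>]) measurable
  have [measurable]: "X (Suc n) \<in> measurable N \<nu>" for n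
    using rv[of "Suc n"] by measurable
  have T_eq: "T = (\<lambda>\<omega> n. X (Suc n) \<omega>)" by (simp add: T_def X_def)
  show T: "T \<in> measurable N (\<Pi>\<^sub>M i\<in>UNIV::nat set. \<nu>)"
    unfolding T_eq by (rule measurable_PiM_single') (auto simp: space_nu)
  have "distr N (\<Pi>\<^sub>M i\<in>{1::nat..}. borel) (\<lambda>\<omega>. \<lambda>i\<in>{1..}. X i \<omega>)
      = (\<Pi>\<^sub>M i\<in>{1::nat..}. distr N borel (X i))"
  proof (rule N.indep_vars_iff_distr_eq_PiM'[THEN iffD1])
    show "N.indep_vars (\<lambda>_. borel) X {1..}"
      using iid unfolding iid_copies_def X_def by blast
  qed (use rv in auto)
  also have "(\<Pi>\<^sub>M i\<in>{1::nat..}. distr N borel (X i)) = (\<Pi>\<^sub>M i\<in>{1::nat..}. \<nu>)"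
    using iid by (intro PiM_cong refl) (auto simp: iid_copies_def X_def \<nu>_def)
  finally have joint: "distr N (\<Pi>\<^sub>M i\<in>{1::nat..}. borel) (\<lambda>\<omega>. \<lambda>i\<in>{1..}. X i \<omega>)
      = (\<Pi>\<^sub>M i\<in>{1::nat..}. \<nu>)" .
  \<comment> \<open>Reindexing by \<open>Suc\<close> turns the product over indices from 1 on into
    the product over all naturals.\<close>
  have "(\<Pi>\<^sub>M i\<in>UNIV::nat set. \<nu>)
      = distr (\<Pi>\<^sub>M i\<in>{1::nat..}. \<nu>) (\<Pi>\<^sub>M i\<in>UNIV::nat set. \<nu>) (\<lambda>\<omega>. \<lambda>n\<in>UNIV. \<omega> (Suc n))"
    by (rule distr_PiM_reindex[symmetric, where f = Suc]) (auto intro: prob)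
  also have "\<dots> = distr (distr N (\<Pi>\<^sub>M i\<in>{1::nat..}. borel) (\<lambda>\<omega>. \<lambda>i\<in>{1..}. X i \<omega>))
      (\<Pi>\<^sub>M i\<in>UNIV::nat set. \<nu>) (\<lambda>\<omega>. \<lambda>n\<in>UNIV. \<omega> (Suc n))"
    by (simp only: joint)
  also have "\<dots> = distr N (\<Pi>\<^sub>M i\<in>UNIV::nat set. \<nu>) T"
  proof (subst distr_distr)
    show "(\<lambda>\<omega>. \<lambda>n\<in>UNIV. \<omega> (Suc n)) \<in> (\<Pi>\<^sub>M i\<in>{1::nat..}. borel) \<rightarrow>\<^sub>M (\<Pi>\<^sub>M i\<in>UNIV::nat set. \<nu>)"
      by (rule measurable_PiM_single') (auto simp: \<nu>_def)
    show "(\<lambda>\<omega>. \<lambda>i\<in>{1..}. X i \<omega>) \<in> N \<rightarrow>\<^sub>M (\<Pi>\<^sub>M i\<in>{1::nat..}. borel)"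
      by (rule measurable_restrict) (use rv in auto)
  qed (simp add: T_eq comp_def restrict_def)
  finally show "distr N (\<Pi>\<^sub>M i\<in>UNIV::nat set. \<nu>) T = (\<Pi>\<^sub>M i\<in>UNIV::nat set. \<nu>)" ..
qed

lemma Upsilon_term_eq_perp_term:
  "Upsilon_term a b \<omega> n = perp_term n (\<lambda>n. (a (Suc n) \<omega>, b (Suc n) \<omega>))"
proof -
  have "partial_product a n \<omega> = multiplier n (\<lambda>n. (a (Suc n) \<omega>, b (Suc n) \<omega>))"
    unfolding partial_product_def multiplier_def
    by (simp add: prod.atLeast1_atMost_eq)
  then show ?thesis by (simp add: Upsilon_term_def perp_term_def)
qed

theorem theorem4p3:
  fixes M :: "'a measure" and \<alpha> \<beta> :: "'a \<Rightarrow> real"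
    and y :: "real \<Rightarrow> real" and Lp Lm :: real
  assumes "prob_space M"
    and "\<alpha> \<in> borel_measurable M" and "\<beta> \<in> borel_measurable M"
    and "\<P>(\<omega> in M. \<alpha> \<omega> \<noteq> 0) = 1"
    and "\<P>(\<omega> in M. \<bar>\<alpha> \<omega>\<bar> \<noteq> 1) > 0"
    and "\<forall>c::real. \<P>(\<omega> in M. \<alpha> \<omega> * (c - \<beta> \<omega>) = c) < 1"
    and "integrable M (\<lambda>\<omega>. ln \<bar>\<alpha> \<omega>\<bar>)" and "0 < (\<integral>\<omega>. ln \<bar>\<alpha> \<omega>\<bar> \<partial>M)"
    and "integrable M (\<lambda>\<omega>. ln (max \<bar>\<beta> \<omega>\<bar> 1))"
    and "bounded_solution M \<alpha> \<beta> y"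
    and "(y \<longlongrightarrow> Lp) at_top" and "(y \<longlongrightarrow> Lm) at_bot"
  shows "(\<P>(\<omega> in M. \<alpha> \<omega> > 0) = 1 \<longrightarrow>
            (\<forall>(N :: 'b measure) a b. iid_copies M \<alpha> \<beta> N a b \<longrightarrow>
               (AE \<omega> in N. summable (Upsilon_term a b \<omega>)) \<and>
               (\<forall>x. y x = (Lp - Lm) * F_Upsilon N a b x + Lm)) \<and>
            continuous_on UNIV y)
       \<and> (\<P>(\<omega> in M. \<alpha> \<omega> < 0) > 0 \<longrightarrow> y constant_on UNIV)"
proof -
  interpret \<Omega>: prob_space M by fact
  note [measurable] = assms(2,3)
  \<comment> \<open>All hypotheses concern only the joint law of the pair, so they are moved to
    \<open>\<nu>\<close>, whose infinite product carries canonical copies.\<close>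
  define \<nu> where "\<nu> = distr M borel (\<lambda>\<omega>. (\<alpha> \<omega>, \<beta> \<omega>))"
  have pair [measurable]: "(\<lambda>\<omega>. (\<alpha> \<omega>, \<beta> \<omega>)) \<in> borel_measurable M" by measurable
  have [measurable_cong]: "sets \<nu> = sets borel" by (simp add: \<nu>_def)
  interpret prob_nu: prob_space \<nu>
    unfolding \<nu>_def by (rule \<Omega>.prob_space_distr) measurable
  have AE_nu: "(AE s in \<nu>. P s) \<longleftrightarrow> (AE \<omega> in M. P (\<alpha> \<omega>, \<beta> \<omega>))"
    if "Measurable.pred borel P" for P
    unfolding \<nu>_def by (rule AE_distr_iff) (use that in auto)
  have integral_nu: "(\<integral>s. h s \<partial>\<nu>) = (\<integral>\<omega>. h (\<alpha> \<omega>, \<beta> \<omega>) \<partial>M)"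
    if "h \<in> borel_measurable borel" for h :: "real \<times> real \<Rightarrow> real"
    unfolding \<nu>_def by (rule integral_distr) (use that in auto)
  have integrable_nu: "integrable \<nu> h \<longleftrightarrow> integrable M (\<lambda>\<omega>. h (\<alpha> \<omega>, \<beta> \<omega>))"
    if "h \<in> borel_measurable borel" for h :: "real \<times> real \<Rightarrow> real"
    unfolding \<nu>_def by (rule integrable_distr_eq) (use that in auto)
  interpret nondegenerate_affine_recursion \<nu>
  proof
    show "AE s in \<nu>. fst s \<noteq> 0"
      using assms(4) by (subst AE_nu) (auto simp: \<Omega>.prob_Collect_eq_1)
    show "integrable \<nu> (\<lambda>s. ln \<bar>fst s\<bar>)"
      using assms(7) by (subst integrable_nu) auto
    show "0 < (\<integral>s. ln \<bar>fst s\<bar> \<partial>\<nu>)"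
      using assms(8) by (subst integral_nu) auto
    show "integrable \<nu> (\<lambda>s. ln (max \<bar>snd s\<bar> 1))"
      using assms(9) by (subst integrable_nu) auto
    show "\<not> (AE s in \<nu>. \<bar>fst s\<bar> = 1)"
    proof (subst AE_nu)
      show "\<not> (AE \<omega> in M. \<bar>fst (\<alpha> \<omega>, \<beta> \<omega>)\<bar> = 1)"
        using assms(5) \<Omega>.prob_Collect_eq_0[of "\<lambda>\<omega>. \<bar>\<alpha> \<omega>\<bar> \<noteq> 1"] by auto
    qed measurable
    show "\<not> (AE s in \<nu>. fst s * (c - snd s) = c)" for c
    proof (subst AE_nu)
      show "\<not> (AE \<omega> in M. fst (\<alpha> \<omega>, \<beta> \<omega>) * (c - snd (\<alpha> \<omega>, \<beta> \<omega>)) = c)"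
        using assms(6)[rule_format, of c] \<Omega>.prob_Collect_eq_1[of "\<lambda>\<omega>. \<alpha> \<omega> * (c - \<beta> \<omega>) = c"] by auto
    qed measurable
  qed (simp_all add: \<nu>_def)
  have y [measurable]: "y \<in> borel_measurable borel" and bdd: "bounded (range y)"
    and eq: "\<And>x. y x = (\<integral>\<omega>. y (\<alpha> \<omega> * (x - \<beta> \<omega>)) \<partial>M)"
    using assms(10) unfolding bounded_solution_def by blast+
  obtain B where B: "\<And>x. \<bar>y x\<bar> \<le> B"
    using bdd by (auto simp: bounded_iff)
  have sol: "y x = (\<integral>s. y (fst s * (x - snd s)) \<partial>\<nu>)" for x
  proof (subst integral_nu)
    show "y x = (\<integral>\<omega>. y (fst (\<alpha> \<omega>, \<beta> \<omega>) * (x - snd (\<alpha> \<omega>, \<beta> \<omega>))) \<partial>M)"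
      unfolding fst_conv snd_conv by (rule eq)
  qed measurable
  show ?thesis
  proof (intro conjI impI allI)
    assume "\<P>(\<omega> in M. \<alpha> \<omega> > 0) = 1"
    then have pos: "AE s in \<nu>. fst s > 0"
      by (subst AE_nu) (auto simp: \<Omega>.prob_Collect_eq_1)
    note rep = solution_eq_cdf_perpetuity[OF y B sol assms(11,12) pos]
    \<comment> \<open>Continuity is read off the representation on the canonical product space,
      hence holds whether or not copies exist on a space of type \<open>'b\<close>.\<close>
    show "continuous_on UNIV y"
      unfolding rep[abs_def] by (intro continuous_intros continuous_cdf_perpetuity)
    fix N :: "'b measure" and a b
    assume iid: "iid_copies M \<alpha> \<beta> N a b"
    define T where "T = (\<lambda>\<omega> n. (a (Suc n) \<omega>, b (Suc n) \<omega>))"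
    have T [measurable]: "T \<in> measurable N S" and distr_T: "distr N S T = S"
      using iid_copies_sequence[OF iid assms(2,3,1)] by (simp_all add: \<nu>_def T_def)
    have terms: "Upsilon_term a b \<omega> = (\<lambda>n. perp_term n (T \<omega>))" for \<omega>
      by (rule ext) (simp add: Upsilon_term_eq_perp_term T_def)
    show "AE \<omega> in N. summable (Upsilon_term a b \<omega>)"
      unfolding terms
      by (rule AE_distrD[OF T, where P = "\<lambda>\<omega>. summable (\<lambda>n. perp_term n \<omega>)"])
        (use AE_summable in \<open>simp only: distr_T\<close>)
    have "Upsilon a b = perpetuity \<circ> T"
      by (rule ext) (simp add: Upsilon_def perpetuity_def terms)
    then have "distr N borel (Upsilon a b) = distr (distr N S T) borel perpetuity"
      by (simp add: distr_distr)
    then show "y x = (Lp - Lm) * F_Upsilon N a b x + Lm" for x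
      by (simp add: F_Upsilon_def distr_T rep)
  next
    assume "\<P>(\<omega> in M. \<alpha> \<omega> < 0) > 0"
    then have "\<not> (AE \<omega> in M. \<not> \<alpha> \<omega> < 0)"
      by (subst (asm) zero_less_measure_iff) (auto simp: \<Omega>.prob_Collect_eq_0)
    moreover have "AE \<omega> in M. \<not> \<alpha> \<omega> < 0" if "AE \<omega> in M. \<alpha> \<omega> > 0"
      using that by eventually_elim simp
    ultimately have neg: "\<not> (AE s in \<nu>. fst s > 0)"
      by (subst AE_nu) auto
    have "Lp = Lm"
      by (rule limits_eq_if_negative[OF y B sol assms(11,12) neg])
    with assms(11,12) have "y x = Lp" for x
      by (intro solution_constant[OF y B sol]) auto
    then show "y constant_on UNIV"
      by (auto simp: constant_on_def)
  qed
qed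

end
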